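(* Let $d>1$, $\alpha>0$. For any $\alpha$-symmetric distribution $P\in\mathcal{P}(\mathbb{R}^d)$ with $P(\{\boldsymbol 0\})=0$ and first marginal distribution function $F(t)=\mathbb{P}(X_1\le t)$, where $\boldsymbol X=(X_1,\dots,X_d)^{\mathsf T}\sim P$, the unique scatter halfspace median matrix of $P$ (i.e. the unique maximizer of $\mathcal{SD}(\cdot;P)$ over $\mathbb{PD}_d$) is $\sigma^2\mathbf{I}$, where $\sigma^2$ (with $\sigma>0$) is the unique solution of the equation $$F\left(\sigma\,d^{1/2-1/\alpha}\right)-\frac12=1-F(\sigma).$$ The maximum scatter halfspace depth of $P$ is $$\mathcal{SD}(\sigma^2\mathbf{I};P)=\max_{\boldsymbol\Sigma\in\mathbb{PD}_d}\mathcal{SD}(\boldsymbol\Sigma;P)=2F\left(\sigma\,d^{1/2-1/\alpha}\right)-1=2-2F(\sigma).$$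
   Context: $\mathcal{P}(\mathbb{R}^d)$ is the set of Borel probability distributions on $\mathbb{R}^d$, $\mathbb{S}^{d-1}$ the Euclidean unit sphere, $\mathbb{PD}_d$ the set of positive definite (symmetric) $d\times d$ real matrices, $\mathbf{I}$ the identity matrix. For $0<\alpha<\infty$, $\|\boldsymbol x\|_\alpha=(\sum_{i=1}^d|x_i|^\alpha)^{1/\alpha}$, and $\|\boldsymbol x\|_\infty=\max_i|x_i|$ (with $1/\alpha=0$ for $\alpha=\infty$). The distribution $P$ of $\boldsymbol X$ is $\alpha$-symmetric if $\mathbb{E}\exp(i\langle\boldsymbol t,\boldsymbol X\rangle)=\phi(\|\boldsymbol t\|_\alpha)$ for all $\boldsymbol t\in\mathbb{R}^d$, with $\phi$ continuous on $\mathbb{R}$; equivalently $\langle\boldsymbol X,\boldsymbol u\rangle$ has the same distribution as $\|\boldsymbol u\|_\alpha X_1$ for all $\boldsymbol u\in\mathbb{S}^{d-1}$. Halfspace depth: $\mathcal{D}(\boldsymbol x;P)=\inf_{\boldsymbol u\in\mathbb{S}^{d-1}}\mathbb{P}(\langle\boldsymbol X,\boldsymbol u\rangle\le\langle\boldsymbol x,\boldsymbol u\rangle)$. The halfspace median $T(P)\in\mathbb{R}^d$ is the barycenter (expectation of the uniform distribution) of the non-empty compact convex set of maximizers of $\mathcal{D}(\cdot;P)$. The scatter halfspace depth of $\boldsymbol\Sigma\in\mathbb{PD}_d$ with respect to $P$ is $$\mathcal{SD}(\boldsymbol\Sigma;P)=\inf_{\boldsymbol u\in\mathbb{S}^{d-1}}\min\left\{\mathbb{P}\left(|\langle\boldsymbol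 X-T(P),\boldsymbol u\rangle|\le\sqrt{\boldsymbol u^{\mathsf T}\boldsymbol\Sigma\boldsymbol u}\right),\ \mathbb{P}\left(|\langle\boldsymbol X-T(P),\boldsymbol u\rangle|\ge\sqrt{\boldsymbol u^{\mathsf T}\boldsymbol\Sigma\boldsymbol u}\right)\right\},\quad \boldsymbol X\sim P.$$
   Formalization: For α > 2 the printed depth value is false (e.g. d=2, α=∞, Cauchy-type law) and is replaced by 2F(σ)−1 = 2−2F(σ d^{1/2−1/α}); for α ≤ 2 it is as printed, and the rest is unchanged for all α. *)

theory Defs
  imports "HOL-Probability.Probability"
begin

definition lp_norm :: "ereal \<Rightarrow> real ^ 'n \<Rightarrow> real" where
  "lp_norm \<alpha> x =
     (if \<alpha> = \<infinity> then Max (range (\<lambda>i. \<bar>x $ i\<bar>))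
      else (\<Sum>i\<in>UNIV. \<bar>x $ i\<bar> powr real_of_ereal \<alpha>) powr (1 / real_of_ereal \<alpha>))"

definition alpha_symmetric :: "ereal \<Rightarrow> (real ^ 'n) measure \<Rightarrow> bool" where
  "alpha_symmetric \<alpha> P \<longleftrightarrow>
     (\<exists>\<phi> :: real \<Rightarrow> complex. continuous_on UNIV \<phi> \<and>
        (\<forall>t. (CLINT x|P. iexp (t \<bullet> x)) = \<phi> (lp_norm \<alpha> t)))"

definition halfspace_depth :: "(real ^ 'n) measure \<Rightarrow> real ^ 'n \<Rightarrow> real" where
  "halfspace_depth P x = (INF u\<in>sphere 0 1. measure P {y. y \<bullet> u \<le> x \<bullet> u})"

text \<open>
  The set of deepest points may have dimension smaller than that of the ambient space, so its
  uniform distribution is taken with respect to Lebesgue measure on its affine hull. That measure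
  is the image of the Lebesgue measure on coefficient vectors with respect to an orthonormal basis
  B of the direction space (a finite set, possibly empty: for a single point the result is a
  Dirac measure). It does not depend on the choice of the origin a and of B.
\<close>

definition affine_hull_lebesgue :: "'a::euclidean_space set \<Rightarrow> 'a measure" where
  "affine_hull_lebesgue C =
     (let a = (SOME a. a \<in> C);
          B = (SOME B. pairwise orthogonal B \<and> (\<forall>b\<in>B. norm b = 1) \<and>
                       span B = span ((\<lambda>x. x - a) ` C))
      in distr (PiM B (\<lambda>_. lborel)) borel (\<lambda>c. a + (\<Sum>b\<in>B. c b *\<^sub>R b)))"

definition barycenter :: "'a::euclidean_space set \<Rightarrow> 'a" where
  "barycenter C = (\<integral>x. x \<partial>uniform_measure (affine_hull_lebesgue C) C)"

definition halfspace_median :: "(real ^ 'n) measure \<Rightarrow> real ^ 'n" where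
  "halfspace_median P = barycenter {x. is_arg_max (halfspace_depth P) (\<lambda>_. True) x}"

definition pos_def :: "real ^ 'n ^ 'n \<Rightarrow> bool" where
  "pos_def A \<longleftrightarrow> transpose A = A \<and> (\<forall>x. x \<noteq> 0 \<longrightarrow> 0 < x \<bullet> (A *v x))"

definition scatter_depth :: "(real ^ 'n) measure \<Rightarrow> real ^ 'n ^ 'n \<Rightarrow> real" where
  "scatter_depth P S =
     (INF u\<in>sphere 0 1.
        min (measure P {x. \<bar>(x - halfspace_median P) \<bullet> u\<bar> \<le> sqrt (u \<bullet> (S *v u))})
            (measure P {x. \<bar>(x - halfspace_median P) \<bullet> u\<bar> \<ge> sqrt (u \<bullet> (S *v u))}))"

end

theory Submission
  imports Defs
begin

text \<open>
  Write \<open>N\<close> for the functional \<open>lp_norm \<alpha>\<close>, \<open>d\<close> for the dimension and \<open>|u|\<close> for the Euclidean norm.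
  By Levy's uniqueness theorem, \<open>\<alpha>\<close>-symmetry says that for every \<open>u \<noteq> 0\<close> the variable
  \<open>X \<bullet> u / N u\<close> has the same law as the coordinate \<open>X $ k\<close> (\<open>distr_inner_eq\<close>, \<open>prob_proj\<close>).
  Only three properties of \<open>N\<close> enter the probabilistic part: it is continuous, absolutely homogeneous and
  positive off the origin.

  \<^emph>\<open>The marginal distribution function.\<close> Fix \<open>x \<noteq> 0\<close>. The map \<open>u \<mapsto> x \<bullet> u / N u\<close> is continuous and odd on the
  punctured space, which is connected as \<open>d \<ge> 2\<close>; its range is therefore a nondegenerate interval that is
  symmetric about \<open>0\<close>. This one observation gives the regularity of \<open>F\<close>. If \<open>x\<close> had positive mass,
  each of the uncountably many values of the map would be an atom of \<open>X $ k\<close>; so the law has no atoms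
  (\<open>prob_singleton\<close>). Then neither has \<open>X $ k\<close>, since for almost every direction \<open>u\<close> an independent copy
  \<open>Y\<close> of \<open>X\<close> satisfies \<open>(X - Y) \<bullet> u \<noteq> 0\<close> almost surely (\<open>prob_marginal_eq\<close>). If \<open>X $ k\<close> had no mass in an
  interval \<open>(a, b)\<close> with \<open>0 \<le> a\<close>, almost every \<open>x\<close> would have a range that avoids \<open>(a, b)\<close>, hence is contained in
  \<open>[-a, a]\<close>, so that \<open>F a = 1\<close>. Thus \<open>F\<close> is continuous, symmetric about \<open>0\<close>, and strictly
  increasing on \<open>[0, \<infinity>)\<close> as long as it is below \<open>1\<close> (\<open>F_strict\<close>). It follows that \<open>0\<close> is the only point of
  maximal depth, so that the halfspace median is \<open>0\<close>, and, by the intermediate value theorem, that the scale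
  equation has exactly one solution.

  \<^emph>\<open>The scatter depth.\<close> With \<open>s u = sqrt (u \<bullet> S u) / N u\<close>, the depth of \<open>S\<close> is the infimum of
  \<open>min (2 F (s u) - 1) (2 - 2 F (s u))\<close>. For a solution \<open>\<sigma>\<close> of the scale equation let \<open>lo \<le> hi\<close> be the numbers
  \<open>\<sigma>\<close> and \<open>\<sigma> c\<close> in increasing order; then \<open>2 F lo - 1 = 2 - 2 F hi\<close>, and a positive definite \<open>S\<close> has at least this depth
  iff \<open>s u\<close> lies in \<open>[lo, hi]\<close> for every \<open>u\<close> (\<open>scatter_depth_ge_iff\<close>). The matrix
  \<open>\<sigma>\<^sup>2 I\<close> has this property because \<open>|u| / N u\<close> ranges between its value \<open>1\<close> at the coordinate vectors and its value \<open>c\<close>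
  at the sign vectors (those with all entries \<open>1\<close> or \<open>-1\<close>). Conversely, for \<open>\<alpha> \<le> 2\<close> the coordinate vectors yield
  \<open>S $ i $ i \<le> \<sigma>\<^sup>2\<close> and the sign vectors yield \<open>v \<bullet> S v \<ge> \<sigma>\<^sup>2 d\<close>; for \<open>\<alpha> > 2\<close> both inequalities are
  reversed. The mean of \<open>v \<bullet> S v\<close> over the sign vectors is the trace of \<open>S\<close>, so equality must hold
  throughout, and \<open>S = \<sigma>\<^sup>2 I\<close> (\<open>scalar_matrix_if_sign_vectors\<close>).
\<close>

section \<open>The functional \<open>lp_norm\<close>\<close>

lemma real_of_ereal_inverse: "real_of_ereal (1 / ereal a) = 1 / a"
  by (simp add: divide_ereal_def inverse_eq_divide)

lemma lp_norm_ereal: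
  "lp_norm (ereal a) x = (\<Sum>i\<in>UNIV. \<bar>x $ i\<bar> powr a) powr (1 / a)"
  by (simp add: lp_norm_def)

lemma lp_norm_infinity_eq_infnorm: "lp_norm \<infinity> (x :: real ^ 'n) = infnorm x"
proof -
  have "range (\<lambda>i. \<bar>x $ i\<bar>) = (\<lambda>b. \<bar>x \<bullet> b\<bar>) ` Basis"
    by (auto simp: Basis_vec_def inner_axis image_iff)
  then show ?thesis by (simp add: lp_norm_def infnorm_Max)
qed

lemma ereal_pos_cases:
  assumes "0 < (\<alpha> :: ereal)"
  obtains (infinity) "\<alpha> = \<infinity>" | (real) a where "\<alpha> = ereal a" "0 < a"
  using assms by (cases \<alpha>) auto

lemma lp_norm_scaleR:
  assumes "0 < \<alpha>"
  shows "lp_norm \<alpha> (s *\<^sub>R x) = \<bar>s\<bar> * lp_norm \<alpha> x"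
  using assms
proof (cases \<alpha> rule: ereal_pos_cases)
  case infinity
  then show ?thesis by (simp add: lp_norm_infinity_eq_infnorm infnorm_mul)
next
  case (real a)
  have "(\<Sum>i\<in>UNIV. \<bar>(s *\<^sub>R x) $ i\<bar> powr a) = \<bar>s\<bar> powr a * (\<Sum>i\<in>UNIV. \<bar>x $ i\<bar> powr a)"
    by (simp add: abs_mult powr_mult sum_distrib_left)
  with real show ?thesis
    by (simp add: lp_norm_ereal powr_mult powr_powr sum_nonneg)
qed

lemma lp_norm_minus: "0 < \<alpha> \<Longrightarrow> lp_norm \<alpha> (- x) = lp_norm \<alpha> x"
  using lp_norm_scaleR[of \<alpha> "-1" x] by simp

lemma lp_norm_zero: "0 < \<alpha> \<Longrightarrow> lp_norm \<alpha> 0 = 0"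
  using lp_norm_scaleR[of \<alpha> 0 0] by simp

lemma lp_norm_pos:
  assumes "0 < \<alpha>" and "x \<noteq> 0"
  shows "0 < lp_norm \<alpha> x"
  using assms(1)
proof (cases \<alpha> rule: ereal_pos_cases)
  case infinity
  then show ?thesis using assms by (simp add: lp_norm_infinity_eq_infnorm infnorm_pos_lt)
next
  case (real a)
  obtain i where "x $ i \<noteq> 0" using assms(2) by (auto simp: vec_eq_iff)
  then have "0 < (\<Sum>i\<in>UNIV. \<bar>x $ i\<bar> powr a)"
    by (intro sum_pos2[of _ i]) auto
  then show ?thesis by (simp add: real lp_norm_ereal)
qed

lemma lp_norm_nonneg: "0 < \<alpha> \<Longrightarrow> 0 \<le> lp_norm \<alpha> x"
  by (cases "x = 0") (auto simp: lp_norm_zero intro: less_imp_le lp_norm_pos)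

lemma continuous_on_lp_norm [continuous_intros]:
  assumes "0 < \<alpha>"
  shows "continuous_on (A :: (real ^ 'n) set) (lp_norm \<alpha>)"
  using assms
proof (cases \<alpha> rule: ereal_pos_cases)
  case infinity
  then have "lp_norm \<alpha> = (infnorm :: real ^ 'n \<Rightarrow> real)" by (auto simp: lp_norm_infinity_eq_infnorm)
  then show ?thesis using continuous_on_infnorm[OF continuous_on_id] by simp
next
  case (real a)
  have "continuous_on A (\<lambda>x :: real ^ 'n. (\<Sum>i\<in>UNIV. \<bar>x $ i\<bar> powr a) powr (1 / a))"
    using real by (intro continuous_on_powr' continuous_intros) (auto simp: sum_nonneg)
  then show ?thesis by (simp add: real lp_norm_ereal[abs_def])
qed

lemma lp_norm_axis:
  assumes "0 < \<alpha>"
  shows "lp_norm \<alpha> (axis k 1 :: real ^ 'n) = 1"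
  using assms
proof (cases \<alpha> rule: ereal_pos_cases)
  case infinity
  have "infnorm (axis k 1 :: real ^ 'n) = 1"
    using component_le_infnorm_cart[of "axis k 1 :: real ^ 'n" k] infnorm_le_norm[of "axis k 1 :: real ^ 'n"]
    by simp
  with infinity show ?thesis by (simp add: lp_norm_infinity_eq_infnorm)
next
  case (real a)
  have "(\<Sum>i\<in>UNIV. \<bar>axis k 1 $ i :: real\<bar> powr a) = (\<Sum>i\<in>UNIV. if i = k then 1 else 0)"
    by (intro sum.cong) (auto simp: axis_def)
  with real show ?thesis by (simp add: lp_norm_ereal)
qed

lemma lp_norm_two: "lp_norm (ereal 2) x = norm x"
  unfolding lp_norm_ereal
  by (simp add: powr_half_sqrt sum_nonneg norm_vec_def L2_set_def)

text \<open>
  By homogeneity it suffices to consider vectors with \<open>lp_norm p y = 1\<close>; their entries are at most \<open>1\<close> in absolute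
  value, and on \<open>[0, 1]\<close> powers decrease in the exponent.
\<close>

lemma lp_norm_antimono:
  assumes "0 < p" and "p \<le> q"
  shows "lp_norm (ereal q) x \<le> lp_norm (ereal p) (x :: real ^ 'n)"
proof (cases "x = 0")
  case False
  define r where "r = lp_norm (ereal p) x"
  define y where "y = x /\<^sub>R r"
  have r: "0 < r" using False assms by (simp add: r_def lp_norm_pos)
  have "lp_norm (ereal p) y = 1"
    using r assms lp_norm_scaleR[of "ereal p" "inverse r" x] by (simp add: y_def r_def)
  then have "((\<Sum>i\<in>UNIV. \<bar>y $ i\<bar> powr p) powr (1 / p)) powr p = 1 powr p"
    by (simp only: lp_norm_ereal)
  then have sum1: "(\<Sum>i\<in>UNIV. \<bar>y $ i\<bar> powr p) = 1"
    using assms by (simp add: powr_powr sum_nonneg)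
  have le1: "\<bar>y $ i\<bar> \<le> 1" for i
  proof -
    have "\<bar>y $ i\<bar> powr p \<le> (\<Sum>i\<in>UNIV. \<bar>y $ i\<bar> powr p)"
      by (rule member_le_sum) auto
    then show ?thesis
      using sum1 assms powr_mono2[of "1/p" "\<bar>y $ i\<bar> powr p" 1] by (simp add: powr_powr)
  qed
  have "(\<Sum>i\<in>UNIV. \<bar>y $ i\<bar> powr q) \<le> (\<Sum>i\<in>UNIV. \<bar>y $ i\<bar> powr p)"
    using le1 assms by (intro sum_mono powr_mono') auto
  then have "lp_norm (ereal q) y \<le> 1"
    using assms sum1 by (simp add: lp_norm_ereal powr_le1 sum_nonneg)
  moreover have "lp_norm (ereal q) y = lp_norm (ereal q) x / r"
    using r assms lp_norm_scaleR[of "ereal q" "inverse r" x] by (simp add: y_def field_simps)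
  ultimately show ?thesis using r by (simp add: field_simps flip: r_def)
qed (use assms in \<open>simp add: lp_norm_zero\<close>)

text \<open>The graph of \<open>t \<mapsto> t powr r\<close> lies above its tangent at \<open>t = 1\<close>.\<close>

lemma powr_ge_tangent:
  fixes t r :: real
  assumes "1 \<le> r" and "0 \<le> t"
  shows "1 + r * (t - 1) \<le> t powr r"
proof (cases "r = 1")
  case False
  with assms have r: "1 < r" by simp
  have "t * 1 \<le> t powr r / r + 1 powr (r / (r - 1)) / (r / (r - 1))"
    using r assms by (intro Youngs_inequality) (auto simp: field_simps)
  then have "t \<le> (t powr r + (r - 1)) / r"
    by (simp add: add_divide_distrib)
  then have "r * t \<le> t powr r + (r - 1)"
    using r by (simp add: le_divide_eq mult.commute)
  then show ?thesis by (simp add: algebra_simps)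
qed (use assms in auto)

text \<open>
  The power mean inequality. After scaling, the mean of the numbers \<open>\<bar>x $ i\<bar> powr p\<close> is \<open>1\<close>, and the
  tangent inequality with exponent \<open>q / p\<close> can be summed over the coordinates.
\<close>

lemma lp_norm_power_mean:
  assumes "0 < p" and "p \<le> q"
  shows "lp_norm (ereal p) x \<le> real CARD('n) powr (1 / p - 1 / q) * lp_norm (ereal q) (x :: real ^ 'n)"
proof (cases "x = 0")
  case False
  let ?d = "real CARD('n)"
  define r where "r = lp_norm (ereal p) x / ?d powr (1 / p)"
  define y where "y = x /\<^sub>R r"
  have q: "0 < q" using assms by simp
  have r: "0 < r" using lp_norm_pos[of "ereal p" x] False assms by (simp add: r_def)
  have "lp_norm (ereal p) y = ?d powr (1 / p)"
    using r assms lp_norm_scaleR[of "ereal p" "inverse r" x] by (auto simp: y_def r_def field_simps)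
  then have "((\<Sum>i\<in>UNIV. \<bar>y $ i\<bar> powr p) powr (1 / p)) powr p = (?d powr (1 / p)) powr p"
    using assms by (simp add: lp_norm_ereal)
  then have sumd: "(\<Sum>i\<in>UNIV. \<bar>y $ i\<bar> powr p) = ?d"
    using assms by (simp add: powr_powr sum_nonneg)
  have "?d = (\<Sum>i\<in>UNIV. 1 + q / p * (\<bar>y $ i\<bar> powr p - 1))"
    by (simp only: sum.distrib sum_subtractf sumd flip: sum_distrib_left) simp
  also have "\<dots> \<le> (\<Sum>i\<in>UNIV. (\<bar>y $ i\<bar> powr p) powr (q / p))"
    using assms by (intro sum_mono powr_ge_tangent) auto
  also have "\<dots> = (\<Sum>i\<in>UNIV. \<bar>y $ i\<bar> powr q)"
    using assms by (simp add: powr_powr)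
  finally have "?d powr (1 / q) \<le> lp_norm (ereal q) y"
    using q unfolding lp_norm_ereal by (intro powr_mono2) auto
  moreover have "lp_norm (ereal q) y = lp_norm (ereal q) x / r"
    using r q lp_norm_scaleR[of "ereal q" "inverse r" x] by (simp add: y_def field_simps)
  ultimately have "r * ?d powr (1 / q) \<le> lp_norm (ereal q) x"
    using r by (simp add: field_simps)
  then have "lp_norm (ereal p) x \<le> lp_norm (ereal q) x * (?d powr (1 / p) / ?d powr (1 / q))"
    by (simp add: r_def field_simps)
  then show ?thesis by (simp add: powr_diff mult.commute)
qed (use assms in \<open>simp add: lp_norm_zero\<close>)

text \<open>
  The value of \<open>norm v / lp_norm \<alpha> v\<close> at the sign vectors \<open>v\<close> in dimension \<open>d\<close>. It is the least value of this
  quotient if \<open>\<alpha> \<le> 2\<close> and the largest one if \<open>\<alpha> > 2\<close>; the other extremal value is \<open>1\<close>.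
\<close>

definition norm_ratio :: "nat \<Rightarrow> ereal \<Rightarrow> real" where
  "norm_ratio d \<alpha> = real d powr (1 / 2 - real_of_ereal (1 / \<alpha>))"

lemma norm_ratio_pos: "0 < norm_ratio CARD('n::finite) \<alpha>"
  by (simp add: norm_ratio_def)

lemma norm_le_lp_norm:
  assumes "0 < \<alpha>" and "\<alpha> \<le> 2"
  shows "norm x \<le> lp_norm \<alpha> x"
    and "norm_ratio CARD('n) \<alpha> * lp_norm \<alpha> x \<le> norm (x :: real ^ 'n)"
proof -
  obtain a where a: "\<alpha> = ereal a" "0 < a" "a \<le> 2"
    using assms by (cases \<alpha>) auto
  show "norm x \<le> lp_norm \<alpha> x"
    using lp_norm_antimono[of a 2 x] a unfolding lp_norm_two by simp
  have "lp_norm \<alpha> x \<le> real CARD('n) powr (1 / a - 1 / 2) * norm x"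
    using lp_norm_power_mean[of a 2 x] a unfolding lp_norm_two by simp
  then have "norm_ratio CARD('n) \<alpha> * lp_norm \<alpha> x
      \<le> real CARD('n) powr (1 / 2 - 1 / a) * (real CARD('n) powr (1 / a - 1 / 2) * norm x)"
    using a by (auto simp: norm_ratio_def real_of_ereal_inverse intro!: mult_left_mono)
  then show "norm_ratio CARD('n) \<alpha> * lp_norm \<alpha> x \<le> norm x"
    by (simp flip: powr_add mult.assoc)
qed

lemma lp_norm_le_norm:
  assumes "2 < \<alpha>"
  shows "lp_norm \<alpha> x \<le> norm x"
    and "norm x \<le> norm_ratio CARD('n) \<alpha> * lp_norm \<alpha> (x :: real ^ 'n)"
proof -
  have "0 < \<alpha>" using assms by (rule less_trans[rotated]) simp
  then have "lp_norm \<alpha> x \<le> norm x \<and> norm x \<le> norm_ratio CARD('n) \<alpha> * lp_norm \<alpha> x"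
  proof (cases \<alpha> rule: ereal_pos_cases)
    case infinity
    then show ?thesis
      using infnorm_le_norm[of x] norm_le_infnorm[of x]
      by (simp add: lp_norm_infinity_eq_infnorm norm_ratio_def powr_half_sqrt)
  next
    case (real a)
    with assms have "2 \<le> a" by simp
    then show ?thesis
      using lp_norm_antimono[of 2 a x] lp_norm_power_mean[of 2 a x] real
      unfolding lp_norm_two by (auto simp: norm_ratio_def real_of_ereal_inverse)
  qed
  then show "lp_norm \<alpha> x \<le> norm x" "norm x \<le> norm_ratio CARD('n) \<alpha> * lp_norm \<alpha> x" by auto
qed

lemma sign_vector_norm:
  fixes v :: "real ^ 'n"
  assumes "0 < \<alpha>" and "\<And>i. \<bar>v $ i\<bar> = 1"
  shows "norm v = sqrt (real CARD('n))"
    and "norm_ratio CARD('n) \<alpha> * lp_norm \<alpha> v = sqrt (real CARD('n))"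
proof -
  have *: "lp_norm (ereal a) v = real CARD('n) powr (1 / a)" for a
    using assms by (simp add: lp_norm_ereal)
  show "norm v = sqrt (real CARD('n))"
    using *[of 2] unfolding lp_norm_two by (simp add: powr_half_sqrt)
  show "norm_ratio CARD('n) \<alpha> * lp_norm \<alpha> v = sqrt (real CARD('n))"
    using assms(1)
  proof (cases \<alpha> rule: ereal_pos_cases)
    case infinity
    then show ?thesis
      using assms by (simp add: lp_norm_def norm_ratio_def powr_half_sqrt)
  next
    case (real a)
    then show ?thesis by (simp add: * norm_ratio_def real_of_ereal_inverse powr_half_sqrt flip: powr_add)
  qed
qed

section \<open>Quadratic forms on sign vectors\<close>

lemma quadratic_form_parallelogram:
  fixes N :: "real ^ 'n ^ 'n"
  shows "(u + v) \<bullet> (N *v (u + v)) + (u - v) \<bullet> (N *v (u - v)) = 2 * (u \<bullet> (N *v u)) + 2 * (v \<bullet> (N *v v))"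
  by (simp add: matrix_vector_right_distrib matrix_vector_mult_diff_distrib inner_add inner_diff)

lemma quadratic_form_axis: "axis i 1 \<bullet> ((N :: real ^ 'n ^ 'n) *v axis j 1) = N $ i $ j"
  by (simp add: inner_axis' matrix_vector_mul_component inner_axis)

text \<open>
  A form with vanishing diagonal is affine in each coordinate. So its value at a vector with a zero entry is the
  mean of its values at the two vectors in which that entry is replaced by \<open>1\<close> and by \<open>-1\<close>, and induction on the number
  of zero entries applies.
\<close>

lemma hollow_form_nonneg:
  fixes N :: "real ^ 'n ^ 'n"
  assumes hollow: "\<And>i. N $ i $ i = 0"
    and signs: "\<And>v. (\<And>i. \<bar>v $ i\<bar> = 1) \<Longrightarrow> 0 \<le> v \<bullet> (N *v v)"
    and u: "\<And>i. u $ i = 0 \<or> \<bar>u $ i\<bar> = 1"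
  shows "0 \<le> u \<bullet> (N *v u)"
  using u
proof (induction "card {i. u $ i = 0}" arbitrary: u)
  case 0
  then have "{i. u $ i = 0} = {}" by simp
  with 0 show ?case by (intro signs) blast
next
  case (Suc n)
  have "{i. u $ i = 0} \<noteq> {}" using Suc.hyps(2) by force
  then obtain i where i: "u $ i = 0" by blast
  have step: "0 \<le> w \<bullet> (N *v w)" if w: "w = u + axis i s" "\<bar>s\<bar> = 1" for w s
  proof (rule Suc.hyps(1))
    have "{j. w $ j = 0} = {j. u $ j = 0} - {i}"
      using i w by (auto simp: axis_def)
    then show "n = card {j. w $ j = 0}"
      using i Suc.hyps(2) by simp
    show "w $ j = 0 \<or> \<bar>w $ j\<bar> = 1" for j
      using i w Suc.prems[of j] by (auto simp: axis_def)
  qed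
  have eq: "u - axis i 1 = u + axis i (-1)" by (simp add: vec_eq_iff axis_def)
  have "0 \<le> (u + axis i 1) \<bullet> (N *v (u + axis i 1)) + (u - axis i 1) \<bullet> (N *v (u - axis i 1))"
    by (rule add_nonneg_nonneg[OF step[OF refl, of 1] step[OF eq]]) simp_all
  then show ?case
    unfolding quadratic_form_parallelogram by (simp add: quadratic_form_axis hollow)
qed

lemma hollow_form_zero:
  fixes N :: "real ^ 'n ^ 'n"
  assumes "transpose N = N" and "\<And>i. N $ i $ i = 0"
    and "\<And>v. (\<And>i. \<bar>v $ i\<bar> = 1) \<Longrightarrow> 0 \<le> v \<bullet> (N *v v)"
  shows "N = 0"
proof -
  have sym: "N $ i $ j = N $ j $ i" for i j
    using arg_cong[OF assms(1), of "\<lambda>M. M $ j $ i"] by (simp add: transpose_def)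
  \<comment> \<open>The form takes the values \<open>2 N\<^sub>i\<^sub>j\<close> and \<open>- 2 N\<^sub>i\<^sub>j\<close> at the sum and the difference of two axis vectors.\<close>
  have "N $ i $ j = 0" for i j
  proof (cases "i = j")
    case False
    let ?e = "axis i 1 :: real ^ 'n" and ?f = "axis j 1 :: real ^ 'n"
    have "0 \<le> (?e + ?f) \<bullet> (N *v (?e + ?f))" "0 \<le> (?e - ?f) \<bullet> (N *v (?e - ?f))"
      by (rule hollow_form_nonneg[OF assms(2,3)]; use False in \<open>auto simp: axis_def\<close>)+
    then show ?thesis
      using sym[of i j]
      by (simp add: matrix_vector_right_distrib matrix_vector_mult_diff_distrib inner_add inner_diff
          quadratic_form_axis assms(2))
  qed (use assms in auto)
  then show ?thesis by (simp add: vec_eq_iff)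
qed

lemma scalar_matrix_if_sign_vectors:
  fixes S :: "real ^ 'n ^ 'n"
  assumes sym: "transpose S = S"
    and diag: "\<And>i. S $ i $ i \<le> s"
    and signs: "\<And>v. (\<And>i. \<bar>v $ i\<bar> = 1) \<Longrightarrow> s * real CARD('n) \<le> v \<bullet> (S *v v)"
  shows "S = s *\<^sub>R mat 1"
proof -
  \<comment> \<open>the diagonal part of \<open>S\<close>; its form equals the trace of \<open>S\<close> at every sign vector\<close>
  define D :: "real ^ 'n ^ 'n" where "D = (\<chi> i j. if i = j then S $ i $ i else 0)"
  have D: "(D *v v) $ i = S $ i $ i * v $ i" for v i
    by (simp add: D_def matrix_vector_mult_def if_distrib[of "\<lambda>x. x * _"] cong: if_cong)
  have vD: "v \<bullet> (D *v v) = (\<Sum>i\<in>UNIV. S $ i $ i)" if "\<And>i. \<bar>v $ i\<bar> = 1" for v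
  proof -
    have "v $ i * v $ i = 1" for i
      using that[of i] abs_mult_self_eq[of "v $ i"] by simp
    then have "v $ i * (S $ i $ i * v $ i) = S $ i $ i" for i
      by (simp only: mult.left_commute[of _ "S $ i $ i"] mult_1_right)
    then show ?thesis
      unfolding inner_vec_def inner_real_def D by (intro sum.cong refl)
  qed
  have trace: "(\<Sum>i\<in>UNIV. S $ i $ i) \<le> s * real CARD('n)"
    using sum_mono[of UNIV "\<lambda>i. S $ i $ i" "\<lambda>_. s"] diag by (simp add: mult.commute)
  have "S - D = 0"
  proof (rule hollow_form_zero)
    show "transpose (S - D) = S - D"
      using sym by (simp add: vec_eq_iff transpose_def D_def)
    show "(S - D) $ i $ i = 0" for i by (simp add: D_def)
    show "0 \<le> v \<bullet> ((S - D) *v v)" if v: "\<And>i. \<bar>v $ i\<bar> = 1" for v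
      using signs[OF v] vD[OF v] trace
      by (simp add: matrix_vector_mult_diff_rdistrib inner_diff)
  qed
  then have SD: "S = D" by simp
  define v :: "real ^ 'n" where "v = 1"
  have v: "\<bar>v $ i\<bar> = 1" for i by (simp add: v_def)
  have "(\<Sum>i\<in>UNIV. s - S $ i $ i) = 0"
    using signs[OF v] vD[OF v] trace SD by (simp add: sum_subtractf)
  then have "s - S $ i $ i = 0" for i
    using diag by (subst (asm) sum_nonneg_eq_0_iff) auto
  then have "D = s *\<^sub>R mat 1"
    by (simp add: D_def mat_def vec_eq_iff)
  with SD show ?thesis by simp
qed

section \<open>Projections of an \<open>\<alpha>\<close>-symmetric law\<close>

text \<open>
  The law \<open>P\<close> of an \<open>\<alpha>\<close>-symmetric random vector in dimension at least two, without mass at the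
  origin, together with a coordinate \<open>k\<close> (its marginal law does not depend on \<open>k\<close>) and the constant \<open>c\<close> of the scale
  equation.
\<close>

locale alpha_symmetric_law = prob_space P
  for P :: "(real ^ 'n) measure" +
  fixes \<alpha> :: ereal and k :: 'n and c :: real
  assumes dim: "1 < CARD('n)"
    and \<alpha>_pos: "0 < \<alpha>"
    and sets_P [measurable_cong]: "sets P = sets borel"
    and symmetric: "alpha_symmetric \<alpha> P"
    and c_eq: "c = norm_ratio CARD('n) \<alpha>"
    and prob_zero: "prob {0} = 0"
begin

text \<open>
  The component of \<open>x\<close> in the direction \<open>u\<close>, scaled so that its law under \<open>P\<close> does not depend on \<open>u\<close>.
  It is \<open>0\<close> for \<open>u = 0\<close>.
\<close>

abbreviation proj :: "real ^ 'n \<Rightarrow> real ^ 'n \<Rightarrow> real" where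
  "proj x u \<equiv> x \<bullet> u / lp_norm \<alpha> u"

text \<open>The distribution function of the \<open>k\<close>-th marginal.\<close>

definition F :: "real \<Rightarrow> real" where
  "F = cdf (distr P borel (\<lambda>x. x $ k))"

lemma space_P [simp]: "space P = UNIV"
  using sets_eq_imp_space_eq[OF sets_P] by simp

lemma lp_pos: "u \<noteq> 0 \<Longrightarrow> 0 < lp_norm \<alpha> u"
  using \<alpha>_pos by (rule lp_norm_pos)

lemma continuous_on_proj: "continuous_on (- {0}) (\<lambda>u. proj x u)"
  by (intro continuous_intros) (use lp_pos \<alpha>_pos in \<open>force+\<close>)

lemma proj_uminus: "proj x (- u) = - proj x u"
  by (simp add: lp_norm_minus \<alpha>_pos)

lemma proj_axis: "proj x (axis i 1) = x $ i"
  by (simp add: lp_norm_axis \<alpha>_pos inner_axis)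

lemma distr_inner_eq: "distr P borel (\<lambda>x. x \<bullet> u) = distr P borel (\<lambda>x. lp_norm \<alpha> u * x $ k)"
proof (rule Levy_uniqueness)
  obtain \<phi> :: "real \<Rightarrow> complex" where
    \<phi>: "(CLINT x|P. iexp (t \<bullet> x)) = \<phi> (lp_norm \<alpha> t)" for t
    using symmetric unfolding alpha_symmetric_def by blast
  have char: "char (distr P borel (\<lambda>x. x \<bullet> v)) t = \<phi> (lp_norm \<alpha> (t *\<^sub>R v))" for v t
  proof -
    have "char (distr P borel (\<lambda>x. x \<bullet> v)) t = (CLINT x|P. iexp ((t *\<^sub>R v) \<bullet> x))"
      by (simp add: char_def integral_distr inner_commute)
    also have "\<dots> = \<phi> (lp_norm \<alpha> (t *\<^sub>R v))"
      by (rule \<phi>)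
    finally show ?thesis .
  qed
  have axis: "(\<lambda>x. lp_norm \<alpha> u * x $ k) = (\<lambda>x. x \<bullet> (lp_norm \<alpha> u *\<^sub>R axis k 1))"
    by (simp add: inner_axis)
  show "char (distr P borel (\<lambda>x. x \<bullet> u)) = char (distr P borel (\<lambda>x. lp_norm \<alpha> u * x $ k))"
    unfolding axis fun_eq_iff char
    by (simp add: lp_norm_scaleR \<alpha>_pos lp_norm_axis lp_norm_nonneg abs_mult)
qed (auto intro!: real_distribution_distr)

lemma prob_proj:
  assumes "u \<noteq> 0" and [measurable]: "A \<in> sets borel"
  shows "prob {x. proj x u \<in> A} = prob {x. x $ k \<in> A}"
proof -
  define B where "B = {t :: real. t / lp_norm \<alpha> u \<in> A}"
  have B [measurable]: "B \<in> sets borel"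
    unfolding B_def by measurable
  have "prob {x. proj x u \<in> A} = measure (distr P borel (\<lambda>x. x \<bullet> u)) B"
    by (subst measure_distr) (auto simp: B_def intro!: arg_cong[where f = prob])
  also have "\<dots> = measure (distr P borel (\<lambda>x. lp_norm \<alpha> u * x $ k)) B"
    by (simp only: distr_inner_eq)
  also have "\<dots> = prob {x. x $ k \<in> A}"
    using lp_pos[OF assms(1)]
    by (subst measure_distr) (auto simp: B_def intro!: arg_cong[where f = prob])
  finally show ?thesis .
qed

lemma connected_proj: "connected ((\<lambda>u. proj x u) ` (- {0}))"
proof (rule connected_continuous_image)
  show "connected (- {0 :: real ^ 'n})"
    using dim by (intro connected_punctured_universe) simp
qed (rule continuous_on_proj)

section \<open>The marginal law has no atoms\<close>

text \<open>
  A point \<open>x \<noteq> 0\<close> of positive mass would make every value of \<open>proj x\<close> an atom of the marginal law. The atoms are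
  countably many, so a continuous function on a connected set that takes its values among them is constant; but
  \<open>proj x\<close> is odd and positive at \<open>x\<close>.
\<close>

lemma prob_singleton: "prob {x} = 0"
proof (cases "x = 0")
  case False
  show ?thesis
  proof (rule ccontr)
    assume "prob {x} \<noteq> 0"
    then have pos: "0 < prob {x}" by (simp add: zero_less_measure_iff)
    interpret \<mu>: real_distribution "distr P borel (\<lambda>x. x $ k)"
      by (rule real_distribution_distr) measurable
    have "(\<lambda>u. proj x u) ` (- {0}) \<subseteq> {t. 0 < \<mu>.prob {t}}"
    proof clarsimp
      fix u :: "real ^ 'n" assume u: "u \<noteq> 0"
      have "prob {x} \<le> prob {y. proj y u \<in> {proj x u}}"
        by (intro finite_measure_mono) auto
      also have "\<dots> = prob {y. y $ k \<in> {proj x u}}"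
        by (rule prob_proj) (use u in auto)
      also have "\<dots> = \<mu>.prob {proj x u}"
        by (subst measure_distr) (auto intro!: arg_cong[where f = prob])
      finally show "0 < \<mu>.prob {proj x u}" using pos by simp
    qed
    then have "countable ((\<lambda>u. proj x u) ` (- {0}))"
      using \<mu>.countable_atoms countable_subset by blast
    moreover have "proj x x \<in> (\<lambda>u. proj x u) ` (- {0})" "proj x (- x) \<in> (\<lambda>u. proj x u) ` (- {0})"
      using False by (intro imageI; simp)+
    ultimately have "proj x x = proj x (- x)"
      using connected_uncountable[OF connected_proj] by blast
    moreover have "0 < proj x x" using False by (intro divide_pos_pos lp_pos) auto
    ultimately show False by (simp only: proj_uminus)
  qed
qed (simp add: prob_zero)

text \<open>
  By Fubini, some direction \<open>u\<close> separates almost all pairs of independent points. If \<open>t\<close> were an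
  atom of the marginal law, the hyperplane \<open>proj x u = t\<close> would have positive mass, and so would the set of
  pairs of points in it.
\<close>

lemma prob_marginal_eq: "prob {x. x $ k = t} = 0"
proof (rule ccontr)
  assume pos: "prob {x. x $ k = t} \<noteq> 0"
  interpret PP: pair_sigma_finite P P ..
  interpret PPL: pair_sigma_finite "P \<Otimes>\<^sub>M P" "lborel :: (real ^ 'n) measure"
    by unfold_locales
  have neq: "AE x in P. AE y in P. x \<noteq> y"
    by (intro AE_I2 AE_I'[where N = "{_}"]) (auto simp: null_sets_def emeasure_eq_measure prob_singleton)
  have "AE z in P \<Otimes>\<^sub>M P. fst z \<noteq> snd z"
    using neq by (subst PP.AE_pair_iff[symmetric]) measurable
  then have "AE z in P \<Otimes>\<^sub>M P. AE u in lborel. (fst z - snd z) \<bullet> u \<noteq> 0"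
  proof (eventually_elim)
    fix z :: "(real ^ 'n) \<times> (real ^ 'n)" assume "fst z \<noteq> snd z"
    then have "{u. (fst z - snd z) \<bullet> u = 0} \<in> null_sets lebesgue"
      unfolding negligible_iff_null_sets[symmetric] by (intro negligible_hyperplane) simp
    then have "AE u in lebesgue. (fst z - snd z) \<bullet> u \<noteq> 0"
      by (rule AE_I') auto
    then show "AE u in lborel. (fst z - snd z) \<bullet> u \<noteq> 0"
      by (simp add: AE_completion_iff)
  qed
  then have "AE u in lborel. AE z in P \<Otimes>\<^sub>M P. (fst z - snd z) \<bullet> u \<noteq> 0"
    by (subst (asm) PPL.AE_commute) measurable
  then have "AE u in lborel. u \<noteq> 0 \<and> (AE z in P \<Otimes>\<^sub>M P. (fst z - snd z) \<bullet> u \<noteq> 0)"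
    using AE_lborel_singleton[of 0] by eventually_elim auto
  then obtain u where u: "u \<noteq> 0" and "AE z in P \<Otimes>\<^sub>M P. (fst z - snd z) \<bullet> u \<noteq> 0"
    using eventually_happens[of "\<lambda>u. u \<noteq> 0 \<and> (AE z in P \<Otimes>\<^sub>M P. (fst z - snd z) \<bullet> u \<noteq> 0)"
        "ae_filter (lborel :: (real ^ 'n) measure)"]
    by (auto simp del: eventually_conj_iff simp: ae_filter_eq_bot_iff)
  then have "AE x in P. AE y in P. (x - y) \<bullet> u \<noteq> 0"
    using PP.AE_pair by fastforce
  moreover have atom: "\<not> (AE x in P. proj x u \<noteq> t)"
  proof
    assume "AE x in P. proj x u \<noteq> t"
    then have "prob {x. proj x u \<in> {t}} = 0"
      by (subst (asm) AE_iff_measurable[OF _ refl]) (auto simp: measure_def)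
    then show False using pos prob_proj[OF u, of "{t}"] by simp
  qed
  ultimately have "\<exists>x. proj x u = t \<and> (AE y in P. (x - y) \<bullet> u \<noteq> 0)"
    by (smt (verit, best) eventually_mono)
  then obtain x where x: "proj x u = t" "AE y in P. (x - y) \<bullet> u \<noteq> 0" by blast
  from x(2) have "AE y in P. proj y u \<noteq> t"
    by eventually_elim (use x(1) lp_pos[OF u] in \<open>auto simp: inner_diff_left field_simps\<close>)
  with atom show False by blast
qed

section \<open>The marginal distribution function\<close>

lemma F_eq: "F t = prob {x. x $ k \<le> t}"
  unfolding F_def cdf_def by (subst measure_distr) (auto intro!: arg_cong[where f = prob])

lemma F_mono: "s \<le> t \<Longrightarrow> F s \<le> F t"
  unfolding F_eq by (intro finite_measure_mono) auto

lemma isCont_F: "isCont F t"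
proof -
  interpret \<mu>: real_distribution "distr P borel (\<lambda>x. x $ k)"
    by (rule real_distribution_distr) measurable
  have "\<mu>.prob {t} = 0"
    using prob_marginal_eq[of t] by (subst measure_distr) (auto simp: vimage_def)
  then show ?thesis unfolding F_def by (simp add: \<mu>.isCont_cdf)
qed

lemma F_tendsto_1: "(F \<longlongrightarrow> 1) at_top"
proof -
  interpret \<mu>: real_distribution "distr P borel (\<lambda>x. x $ k)"
    by (rule real_distribution_distr) measurable
  show ?thesis unfolding F_def by (rule \<mu>.cdf_lim_at_top_prob)
qed

lemma F_le_1: "F t \<le> 1"
  by (simp add: F_eq)

lemma prob_marginal_less: "prob {x. x $ k < t} = F t"
proof -
  have "F t = prob ({x. x $ k < t} \<union> {x. x $ k = t})"
    unfolding F_eq by (intro arg_cong[where f = prob]) auto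
  also have "\<dots> = prob {x. x $ k < t}"
    by (subst finite_measure_Union) (auto simp: prob_marginal_eq)
  finally show ?thesis by simp
qed

lemma F_minus: "F (- t) = 1 - F t"
proof -
  have "F (- t) = prob {x. proj x (- axis k 1) \<in> {.. - t}}"
    unfolding F_eq by (subst prob_proj) (auto simp: axis_eq_0_iff)
  also have "\<dots> = prob (space P - {x. x $ k < t})"
    unfolding proj_uminus proj_axis by (intro arg_cong[where f = prob]) auto
  also have "\<dots> = 1 - F t"
    by (subst prob_compl) (auto simp: prob_marginal_less)
  finally show ?thesis .
qed

lemma F_zero: "F 0 = 1 / 2"
  using F_minus[of 0] by simp

text \<open>
  For \<open>u\<close> in a countable dense set, almost surely \<open>proj X u\<close> avoids the gap; by continuity in \<open>u\<close> the whole range of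
  \<open>proj X\<close> does. The range is an interval that is symmetric about \<open>0\<close>, so it has no point above the gap either.
\<close>

lemma F_eq_1_if_gap:
  assumes "0 \<le> a" "a < b" and gap: "prob {x. a < x $ k \<and> x $ k < b} = 0"
  shows "F a = 1"
proof -
  obtain D :: "(real ^ 'n) set" where D: "countable D"
    "\<And>X. open X \<Longrightarrow> X \<noteq> {} \<Longrightarrow> \<exists>d\<in>D. d \<in> X"
    using countable_dense_setE by blast
  have "AE x in P. \<forall>u\<in>D - {0}. proj x u \<notin> {a<..<b}"
  proof (subst AE_ball_countable, use D(1) in simp, intro ballI)
    fix u assume "u \<in> D - {0}"
    then have "prob {x. proj x u \<in> {a<..<b}} = 0"
      using prob_proj[of u "{a<..<b}"] gap by auto
    then show "AE x in P. proj x u \<notin> {a<..<b}"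
      by (intro AE_I'[of "{x. proj x u \<in> {a<..<b}}"]) (auto simp: null_sets_def emeasure_eq_measure)
  qed
  then have "AE x in P. x $ k \<le> a"
  proof eventually_elim
    fix x assume x: "\<forall>u\<in>D - {0}. proj x u \<notin> {a<..<b}"
    show "x $ k \<le> a"
    proof (rule ccontr)
      assume "\<not> x $ k \<le> a"
      \<comment> \<open>a point of the gap between \<open>- x $ k\<close> and \<open>x $ k\<close>\<close>
      define m where "m = (a + min b (x $ k)) / 2"
      have m: "a < m" "m < b" "m < x $ k" using assms \<open>\<not> x $ k \<le> a\<close> by (auto simp: m_def)
      let ?I = "(\<lambda>u. proj x u) ` (- {0})"
      have "proj x (axis k 1) \<in> ?I" "proj x (- axis k 1) \<in> ?I"
        by (intro imageI; simp add: axis_eq_0_iff)+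
      then have "x $ k \<in> ?I" "- x $ k \<in> ?I"
        unfolding proj_uminus proj_axis by auto
      then have "m \<in> ?I"
        using connected_proj[of x] m assms unfolding connected_iff_interval
        by (meson less_imp_le order_trans neg_le_0_iff_le le_less_trans)
      then have "{u \<in> - {0}. proj x u \<in> {a<..<b}} \<noteq> {}"
        using m by auto
      moreover have "open {u \<in> - {0}. proj x u \<in> {a<..<b}}"
      proof -
        have "open ((\<lambda>u. proj x u) -` {a<..<b} \<inter> - {0})"
          using continuous_on_proj[of x] by (subst (asm) continuous_on_open_vimage) auto
        then show ?thesis by (simp add: vimage_def Int_def conj_commute)
      qed
      ultimately obtain d where "d \<in> D" "d \<in> {u \<in> - {0}. proj x u \<in> {a<..<b}}"
        using D(2) by blast
      with x show False by auto
    qed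
  qed
  then show ?thesis
    using prob_Collect_eq_1[of "\<lambda>x. x $ k \<le> a"] by (simp add: F_eq)
qed

lemma F_strict:
  assumes "0 \<le> a" "a < b" "F a < 1"
  shows "F a < F b"
proof (rule ccontr)
  assume "\<not> F a < F b"
  have "F b = prob ({x. x $ k \<le> a} \<union> {x. a < x $ k \<and> x $ k \<le> b})"
    unfolding F_eq using assms by (intro arg_cong[where f = prob]) auto
  also have "\<dots> = F a + prob {x. a < x $ k \<and> x $ k \<le> b}"
    unfolding F_eq by (rule finite_measure_Union) auto
  finally have "prob {x. a < x $ k \<and> x $ k \<le> b} \<le> 0"
    using \<open>\<not> F a < F b\<close> by simp
  moreover have "prob {x. a < x $ k \<and> x $ k < b} \<le> prob {x. a < x $ k \<and> x $ k \<le> b}"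
    by (intro finite_measure_mono) auto
  ultimately have "prob {x. a < x $ k \<and> x $ k < b} = 0"
    by (simp add: measure_le_0_iff)
  from F_eq_1_if_gap[OF assms(1,2) this] assms(3) show False by simp
qed

lemma F_gt_half: "0 < t \<Longrightarrow> 1 / 2 < F t"
  using F_strict[of 0 t] by (simp add: F_zero)

lemma F_lt_half: "t < 0 \<Longrightarrow> F t < 1 / 2"
  using F_gt_half[of "- t"] F_minus[of t] by simp

end


section \<open>The halfspace median\<close>

text \<open>
  The uniform distribution on \<open>{0}\<close> is concentrated on \<open>0\<close>, whatever the reference measure.
\<close>

lemma barycenter_zero: "barycenter {0 :: 'a :: euclidean_space} = 0"
proof -
  have "AE x in uniform_measure (affine_hull_lebesgue {0 :: 'a}) {0}. x = 0"
    by (rule AE_uniform_measureI) (auto simp: affine_hull_lebesgue_def Let_def)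
  then show ?thesis
    unfolding barycenter_def by (rule integral_eq_zero_AE)
qed

context alpha_symmetric_law
begin

lemma prob_halfspace:
  assumes "u \<noteq> 0"
  shows "prob {y. y \<bullet> u \<le> x \<bullet> u} = F (proj x u)"
proof -
  have "prob {y. y \<bullet> u \<le> x \<bullet> u} = prob {y. proj y u \<in> {..proj x u}}"
    using lp_pos[OF assms] by (simp add: divide_le_cancel)
  also have "\<dots> = F (proj x u)"
    unfolding prob_proj[OF assms borel_closed[OF closed_atMost]] by (simp add: F_eq)
  finally show ?thesis .
qed

lemma halfspace_depth_zero: "halfspace_depth P 0 = 1 / 2"
proof -
  have "halfspace_depth P 0 = (INF u\<in>sphere 0 1 :: (real ^ 'n) set. 1 / 2)"
    unfolding halfspace_depth_def
  proof (rule INF_cong)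
    fix u :: "real ^ 'n" assume "u \<in> sphere 0 1"
    then have "u \<noteq> 0" by auto
    then show "prob {y. y \<bullet> u \<le> 0 \<bullet> u} = 1 / 2"
      by (subst prob_halfspace) (auto simp: F_zero)
  qed simp
  then show ?thesis by simp
qed

lemma halfspace_depth_lt_half:
  assumes "x \<noteq> 0"
  shows "halfspace_depth P x < 1 / 2"
proof -
  define u where "u = - (x /\<^sub>R norm x)"
  have u: "norm u = 1" "u \<noteq> 0" "x \<bullet> u < 0" using assms by (auto simp: u_def)
  have "halfspace_depth P x \<le> prob {y. y \<bullet> u \<le> x \<bullet> u}"
    unfolding halfspace_depth_def
    by (rule cINF_lower) (use u in \<open>auto intro!: bdd_belowI[of _ 0]\<close>)
  also have "\<dots> < 1 / 2"
    unfolding prob_halfspace[OF u(2)] using u by (intro F_lt_half divide_neg_pos lp_pos)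
  finally show ?thesis .
qed

lemma halfspace_median_eq_0: "halfspace_median P = 0"
proof -
  have "{x. is_arg_max (halfspace_depth P) (\<lambda>_. True) x} = {0}"
  proof (intro equalityI subsetI; clarsimp simp: is_arg_max_linorder)
    fix x assume "\<forall>y. halfspace_depth P y \<le> halfspace_depth P x"
    then have "1 / 2 \<le> halfspace_depth P x" using halfspace_depth_zero by metis
    then show "x = 0" using halfspace_depth_lt_half by fastforce
  next
    fix y show "halfspace_depth P y \<le> halfspace_depth P 0"
      using halfspace_depth_lt_half[of y] halfspace_depth_zero by (cases "y = 0") auto
  qed
  then show ?thesis by (simp add: halfspace_median_def barycenter_zero)
qed

section \<open>The scatter halfspace depth\<close>

text \<open>
  The threshold \<open>sqrt (u \<bullet> (S *v u))\<close> of the scatter depth in the direction \<open>u\<close>, on the scale on which all projections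
  are distributed as the \<open>k\<close>-th coordinate. It depends on the direction of \<open>u\<close> only.
\<close>

definition spread :: "real ^ 'n ^ 'n \<Rightarrow> real ^ 'n \<Rightarrow> real" where
  "spread S u = sqrt (u \<bullet> (S *v u)) / lp_norm \<alpha> u"

lemma spread_scaleR:
  assumes "t \<noteq> 0"
  shows "spread S (t *\<^sub>R u) = spread S u"
proof -
  have "(t *\<^sub>R u) \<bullet> (S *v (t *\<^sub>R u)) = t\<^sup>2 * (u \<bullet> (S *v u))"
    by (simp add: matrix_vector_mult_scaleR power2_eq_square)
  then show ?thesis
    using assms by (simp add: spread_def real_sqrt_mult lp_norm_scaleR \<alpha>_pos)
qed

lemma prob_slab:
  assumes "u \<noteq> 0" "0 \<le> s"
  shows "prob {x. \<bar>x \<bullet> u\<bar> \<le> s} = 2 * F (s / lp_norm \<alpha> u) - 1"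
    and "prob {x. \<bar>x \<bullet> u\<bar> \<ge> s} = 2 - 2 * F (s / lp_norm \<alpha> u)"
proof -
  define t where "t = s / lp_norm \<alpha> u"
  note pos = lp_pos[OF assms(1)]
  have t: "0 \<le> t" using assms pos by (simp add: t_def)
  have "prob {x. \<bar>x \<bullet> u\<bar> \<le> s} = prob {x. proj x u \<in> {-t..t}}"
    using pos by (intro arg_cong[where f = prob]) (auto simp: t_def abs_le_iff field_simps)
  also have "\<dots> = prob ({x. x $ k \<le> t} - {x. x $ k < - t})"
    unfolding prob_proj[OF assms(1) borel_closed[OF closed_atLeastAtMost]]
    by (intro arg_cong[where f = prob]) auto
  also have "\<dots> = F t - F (- t)"
    using t by (subst finite_measure_Diff) (auto simp: prob_marginal_less simp flip: F_eq)
  finally show "prob {x. \<bar>x \<bullet> u\<bar> \<le> s} = 2 * F (s / lp_norm \<alpha> u) - 1"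
    by (simp add: F_minus t_def)
  have "prob {x. \<bar>x \<bullet> u\<bar> \<ge> s} = prob {x. proj x u \<in> - {-t<..<t}}"
    using pos by (intro arg_cong[where f = prob]) (auto simp: t_def abs_if field_simps)
  also have "\<dots> = prob (space P - ({x. x $ k < t} - {x. x $ k \<le> - t}))"
    by (subst prob_proj[OF assms(1)]) (auto intro!: arg_cong[where f = prob])
  also have "\<dots> = 1 - prob ({x. x $ k < t} - {x. x $ k \<le> - t})"
    by (rule prob_compl) measurable
  also have "prob ({x. x $ k < t} - {x. x $ k \<le> - t}) = 2 * F t - 1"
  proof (cases "t = 0")
    case True
    then have "{x. x $ k < t} - {x. x $ k \<le> - t} = {}" by auto
    then show ?thesis using True by (simp only: F_zero) simp
  next
    case False
    with t show ?thesis
      by (subst finite_measure_Diff) (auto simp: prob_marginal_less F_minus simp flip: F_eq)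
  qed
  finally show "prob {x. \<bar>x \<bullet> u\<bar> \<ge> s} = 2 - 2 * F (s / lp_norm \<alpha> u)"
    by (simp add: t_def)
qed

lemma scatter_depth_eq:
  assumes "pos_def S"
  shows "scatter_depth P S = (INF u\<in>sphere 0 1. min (2 * F (spread S u) - 1) (2 - 2 * F (spread S u)))"
  unfolding scatter_depth_def halfspace_median_eq_0
proof (rule INF_cong)
  fix u :: "real ^ 'n" assume "u \<in> sphere 0 1"
  then have u: "u \<noteq> 0" by auto
  with assms have "0 < u \<bullet> (S *v u)" by (simp add: pos_def_def)
  then show "min (prob {x. \<bar>(x - 0) \<bullet> u\<bar> \<le> sqrt (u \<bullet> (S *v u))})
      (prob {x. sqrt (u \<bullet> (S *v u)) \<le> \<bar>(x - 0) \<bullet> u\<bar>})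
    = min (2 * F (spread S u) - 1) (2 - 2 * F (spread S u))"
    using u by (simp add: prob_slab spread_def)
qed simp

lemma scatter_depth_le:
  assumes "pos_def S" "u \<noteq> 0"
  shows "scatter_depth P S \<le> min (2 * F (spread S u) - 1) (2 - 2 * F (spread S u))"
proof -
  have "spread S u = spread S (u /\<^sub>R norm u)"
    using assms(2) by (simp add: spread_scaleR)
  moreover have "scatter_depth P S
      \<le> min (2 * F (spread S (u /\<^sub>R norm u)) - 1) (2 - 2 * F (spread S (u /\<^sub>R norm u)))"
    unfolding scatter_depth_eq[OF assms(1)]
  proof (rule cINF_lower)
    have "0 \<le> F (spread S v)" for v by (simp add: F_eq)
    then have "-1 \<le> min (2 * F (spread S v) - 1) (2 - 2 * F (spread S v))" for v
      using F_le_1[of "spread S v"] by simp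
    then show "bdd_below ((\<lambda>u. min (2 * F (spread S u) - 1) (2 - 2 * F (spread S u))) ` sphere 0 1)"
      by (auto intro!: bdd_belowI[of _ "-1"])
  qed (use assms(2) in simp)
  ultimately show ?thesis by simp
qed

text \<open>
  The two sides of the equation are the depths contributed by the thresholds \<open>lo\<close> and \<open>hi\<close>. Since both exceed
  \<open>0\<close>, the equation forces \<open>F lo < 1\<close> and \<open>F hi < 1\<close>, and \<open>F\<close> is strictly increasing there.
\<close>

lemma scatter_depth_ge_iff:
  assumes S: "pos_def S" and "0 < lo" "0 < hi" and eq: "2 * F lo - 1 = 2 - 2 * F hi"
  shows "2 * F lo - 1 \<le> scatter_depth P S \<longleftrightarrow> (\<forall>u :: real ^ 'n. u \<noteq> 0 \<longrightarrow> lo \<le> spread S u \<and> spread S u \<le> hi)"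
proof (intro iffI allI impI)
  fix u :: "real ^ 'n" assume ge: "2 * F lo - 1 \<le> scatter_depth P S" and u: "u \<noteq> 0"
  have half: "1 / 2 < F lo" "1 / 2 < F hi" using assms F_gt_half by auto
  have F: "F lo \<le> F (spread S u)" "F (spread S u) \<le> F hi"
    using scatter_depth_le[OF S u] ge eq by auto
  have "0 \<le> spread S u"
    using S u lp_pos[OF u] by (auto simp: spread_def pos_def_def intro!: divide_nonneg_nonneg less_imp_le)
  then show "lo \<le> spread S u \<and> spread S u \<le> hi"
    using F_strict[of "spread S u" lo] F_strict[of hi "spread S u"] F half eq assms by linarith
next
  assume *: "\<forall>u. u \<noteq> 0 \<longrightarrow> lo \<le> spread S u \<and> spread S u \<le> hi"
  show "2 * F lo - 1 \<le> scatter_depth P S"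
    unfolding scatter_depth_eq[OF S]
  proof (rule cINF_greatest)
    fix u :: "real ^ 'n" assume "u \<in> sphere 0 1"
    then have "u \<noteq> 0" by auto
    with * have "F lo \<le> F (spread S u)" "F (spread S u) \<le> F hi" by (auto intro: F_mono)
    then show "2 * F lo - 1 \<le> min (2 * F (spread S u) - 1) (2 - 2 * F (spread S u))"
      using eq by simp
  qed simp
qed

lemma c_pos: "0 < c" by (simp add: c_eq norm_ratio_pos)

lemma pos_def_scalar: "0 < \<sigma> \<Longrightarrow> pos_def (\<sigma>\<^sup>2 *\<^sub>R mat 1 :: real ^ 'n ^ 'n)"
  by (simp add: pos_def_def scaleR_matrix_vector_assoc[symmetric] transpose_scalar)

lemma spread_scalar: "0 < \<sigma> \<Longrightarrow> spread (\<sigma>\<^sup>2 *\<^sub>R mat 1) u = \<sigma> * (norm u / lp_norm \<alpha> u)"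
  by (simp add: spread_def scaleR_matrix_vector_assoc[symmetric] real_sqrt_mult norm_eq_sqrt_inner)

text \<open>The least and the largest value of \<open>norm u / lp_norm \<alpha> u\<close> over \<open>u \<noteq> 0\<close>.\<close>

definition low :: real where "low = (if \<alpha> \<le> 2 then c else 1)"
definition high :: real where "high = (if \<alpha> \<le> 2 then 1 else c)"

lemma norm_quotient_bounds:
  assumes "(u :: real ^ 'n) \<noteq> 0"
  shows "low \<le> norm u / lp_norm \<alpha> u" "norm u / lp_norm \<alpha> u \<le> high"
  using norm_le_lp_norm[OF \<alpha>_pos, of u] lp_norm_le_norm[of \<alpha> u] lp_pos[OF assms]
  by (auto simp: low_def high_def simp flip: c_eq simp: pos_le_divide_eq pos_divide_le_eq)

text \<open>
  The band for the spread encodes the inequalities on the diagonal entries of \<open>S\<close> (axis vectors) and on the form of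
  \<open>S\<close> at the sign vectors that force \<open>S\<close> to be scalar. For \<open>\<alpha> > 2\<close> they hold for \<open>- S\<close>.
\<close>

lemma spread_in_band_iff:
  fixes S :: "real ^ 'n ^ 'n"
  assumes S: "pos_def S" and \<sigma>: "0 < \<sigma>"
  shows "(\<forall>u. u \<noteq> 0 \<longrightarrow> \<sigma> * low \<le> spread S u \<and> spread S u \<le> \<sigma> * high) \<longleftrightarrow> S = \<sigma>\<^sup>2 *\<^sub>R mat 1"
proof
  assume S_eq: "S = \<sigma>\<^sup>2 *\<^sub>R mat 1"
  show "\<forall>u. u \<noteq> 0 \<longrightarrow> \<sigma> * low \<le> spread S u \<and> spread S u \<le> \<sigma> * high"
    unfolding S_eq spread_scalar[OF \<sigma>]
    using \<sigma> norm_quotient_bounds by (intro allI impI conjI mult_left_mono) auto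
next
  assume band: "\<forall>u. u \<noteq> 0 \<longrightarrow> \<sigma> * low \<le> spread S u \<and> spread S u \<le> \<sigma> * high"
  have sym: "transpose S = S" using S by (simp add: pos_def_def)
  have axis: "spread S (axis i 1) = sqrt (S $ i $ i)" for i
    by (simp add: spread_def quadratic_form_axis lp_norm_axis \<alpha>_pos)
  have diag_band: "\<sigma> * low \<le> sqrt (S $ i $ i)" "sqrt (S $ i $ i) \<le> \<sigma> * high" for i
    using band[rule_format, of "axis i 1"] axis[of i] by (auto simp: axis_eq_0_iff)
  have sign: "v \<noteq> 0" "spread S v = c * sqrt (v \<bullet> (S *v v) / real CARD('n))"
    if v: "\<And>i. \<bar>v $ i\<bar> = 1" for v :: "real ^ 'n"
  proof -
    show "v \<noteq> 0" using v[of k] by auto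
    have "lp_norm \<alpha> v = sqrt (real CARD('n)) / c"
      using sign_vector_norm(2)[OF \<alpha>_pos v] c_pos by (simp add: c_eq field_simps)
    then show "spread S v = c * sqrt (v \<bullet> (S *v v) / real CARD('n))"
      by (simp add: spread_def real_sqrt_divide)
  qed
  have square_le: "\<sigma>\<^sup>2 \<le> t" if "\<sigma> \<le> sqrt t" for t
    using that \<sigma> real_sqrt_le_iff[of "\<sigma>\<^sup>2" t] by simp
  show "S = \<sigma>\<^sup>2 *\<^sub>R mat 1"
  proof (cases "\<alpha> \<le> 2")
    case True
    show ?thesis
    proof (rule scalar_matrix_if_sign_vectors[OF sym])
      show "S $ i $ i \<le> \<sigma>\<^sup>2" for i
        using diag_band(2)[of i] True \<sigma> by (simp add: high_def sqrt_le_D)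
      fix v :: "real ^ 'n" assume v: "\<And>i. \<bar>v $ i\<bar> = 1"
      have "c * \<sigma> \<le> c * sqrt (v \<bullet> (S *v v) / real CARD('n))"
        using band[rule_format, OF sign(1)[OF v]] sign(2)[OF v] True by (simp add: low_def mult.commute)
      then have "\<sigma> \<le> sqrt (v \<bullet> (S *v v) / real CARD('n))"
        using c_pos by simp
      then have "\<sigma>\<^sup>2 \<le> v \<bullet> (S *v v) / real CARD('n)"
        by (rule square_le)
      then show "\<sigma>\<^sup>2 * real CARD('n) \<le> v \<bullet> (S *v v)"
        by (simp add: field_simps)
    qed
  next
    case False
    have "- S = (- \<sigma>\<^sup>2) *\<^sub>R mat 1"
    proof (rule scalar_matrix_if_sign_vectors)
      show "transpose (- S) = - S"
        using sym by (simp add: transpose_def vec_eq_iff)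
      have "\<sigma>\<^sup>2 \<le> S $ i $ i" for i
        using diag_band(1)[of i] False by (intro square_le) (simp add: low_def)
      then show "(- S) $ i $ i \<le> - \<sigma>\<^sup>2" for i by simp
      fix v :: "real ^ 'n" assume v: "\<And>i. \<bar>v $ i\<bar> = 1"
      have "c * sqrt (v \<bullet> (S *v v) / real CARD('n)) \<le> c * \<sigma>"
        using band[rule_format, OF sign(1)[OF v]] sign(2)[OF v] False by (simp add: high_def mult.commute)
      then have "sqrt (v \<bullet> (S *v v) / real CARD('n)) \<le> \<sigma>"
        using c_pos by simp
      then have "v \<bullet> (S *v v) / real CARD('n) \<le> \<sigma>\<^sup>2"
        by (rule sqrt_le_D)
      then have "v \<bullet> (S *v v) \<le> \<sigma>\<^sup>2 * real CARD('n)"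
        by (simp add: field_simps)
      moreover have "v \<bullet> ((- S) *v v) = - (v \<bullet> (S *v v))"
        using matrix_vector_mult_diff_rdistrib[of 0 S v] by simp
      ultimately show "- \<sigma>\<^sup>2 * real CARD('n) \<le> v \<bullet> ((- S) *v v)" by simp
    qed
    then show ?thesis by simp
  qed
qed

lemma scatter_depth_maximum:
  assumes \<sigma>: "0 < \<sigma>" and eq: "F (\<sigma> * c) - 1 / 2 = 1 - F \<sigma>"
  shows "is_arg_max (scatter_depth P) pos_def S \<longleftrightarrow> S = \<sigma>\<^sup>2 *\<^sub>R mat 1"
    and "scatter_depth P (\<sigma>\<^sup>2 *\<^sub>R mat 1) = 2 * F (\<sigma> * low) - 1"
proof -
  let ?I = "\<sigma>\<^sup>2 *\<^sub>R mat 1 :: real ^ 'n ^ 'n"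
  have pos: "0 < \<sigma> * low" "0 < \<sigma> * high"
    using \<sigma> c_pos by (auto simp: low_def high_def)
  have eq': "2 * F (\<sigma> * low) - 1 = 2 - 2 * F (\<sigma> * high)"
    using eq by (auto simp: low_def high_def)
  have ge: "2 * F (\<sigma> * low) - 1 \<le> scatter_depth P S \<longleftrightarrow> S = ?I" if "pos_def S" for S
    using scatter_depth_ge_iff[OF that pos eq'] spread_in_band_iff[OF that \<sigma>] by simp
  have pd: "pos_def ?I" using \<sigma> by (rule pos_def_scalar)
  show depth: "scatter_depth P ?I = 2 * F (\<sigma> * low) - 1"
  proof (rule antisym)
    \<comment> \<open>the lower bound is attained at the vector of ones for \<open>\<alpha> \<le> 2\<close>, at an axis vector for \<open>\<alpha> > 2\<close>\<close>
    obtain u :: "real ^ 'n" where "u \<noteq> 0" "norm u / lp_norm \<alpha> u = low"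
    proof (cases "\<alpha> \<le> 2")
      case True
      have "(1 :: real ^ 'n) \<noteq> 0" by simp
      moreover have "norm (1 :: real ^ 'n) / lp_norm \<alpha> (1 :: real ^ 'n) = low"
        using sign_vector_norm[OF \<alpha>_pos, of "1 :: real ^ 'n"] c_pos lp_pos[of "1 :: real ^ 'n"] True
        by (simp add: low_def divide_eq_eq flip: c_eq)
      ultimately show ?thesis using that by blast
    next
      case False
      with that[of "axis k 1"] show ?thesis
        by (simp add: axis_eq_0_iff lp_norm_axis \<alpha>_pos low_def)
    qed
    then show "scatter_depth P ?I \<le> 2 * F (\<sigma> * low) - 1"
      using scatter_depth_le[OF pd, of u] \<sigma> by (simp add: spread_scalar)
  qed (use ge[OF pd] in simp)
  show "is_arg_max (scatter_depth P) pos_def S \<longleftrightarrow> S = ?I"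
  proof
    assume "is_arg_max (scatter_depth P) pos_def S"
    then show "S = ?I"
      using pd ge[of S] depth by (auto simp: is_arg_max_linorder)
  next
    assume "S = ?I"
    then show "is_arg_max (scatter_depth P) pos_def S"
      using pd ge depth by (fastforce simp: is_arg_max_def)
  qed
qed

section \<open>The scale equation\<close>

lemma ex1_scale: "\<exists>!\<sigma>. 0 < \<sigma> \<and> F (\<sigma> * c) - 1 / 2 = 1 - F \<sigma>"
proof (rule ex_ex1I)
  let ?H = "\<lambda>\<sigma>. F (\<sigma> * c) + F \<sigma>"
  have "(?H \<longlongrightarrow> 1 + 1) at_top"
  proof (intro tendsto_add)
    have "filterlim (\<lambda>\<sigma>. \<sigma> * c) at_top at_top"
      by (rule filterlim_at_top_mult_tendsto_pos[OF tendsto_const c_pos filterlim_ident])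
    then show "((\<lambda>\<sigma>. F (\<sigma> * c)) \<longlongrightarrow> 1) at_top"
      by (rule filterlim_compose[OF F_tendsto_1])
  qed (rule F_tendsto_1)
  then have "\<forall>\<^sub>F \<sigma> in at_top. 3 / 2 < ?H \<sigma>"
    by (rule order_tendstoD) simp
  then have "\<forall>\<^sub>F \<sigma> in at_top. 3 / 2 < ?H \<sigma> \<and> 0 < \<sigma>"
    using eventually_gt_at_top[of 0] by eventually_elim simp
  then obtain b where b: "3 / 2 < ?H b" "0 < b"
    using eventually_happens'[OF trivial_limit_at_top_linorder] by blast
  have "isCont ?H t" for t
    by (intro isCont_add isCont_F isCont_o2[where g = F] continuous_intros)
  then obtain \<sigma> where \<sigma>: "0 \<le> \<sigma>" "?H \<sigma> = 3 / 2"
    using IVT[of ?H 0 "3 / 2" b] b by (auto simp: F_zero)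
  moreover have "\<sigma> \<noteq> 0" using \<sigma> by (auto simp: F_zero)
  ultimately show "\<exists>\<sigma>. 0 < \<sigma> \<and> F (\<sigma> * c) - 1 / 2 = 1 - F \<sigma>"
    by (intro exI[of _ \<sigma>]) auto
next
  have *: "\<not> s < t" if "0 < s" "F (s * c) - 1 / 2 = 1 - F s" "F (t * c) - 1 / 2 = 1 - F t" for s t
  proof
    assume "s < t"
    have "F s < 1" using that F_gt_half[of "s * c"] c_pos by simp
    then have "F s < F t" using that \<open>s < t\<close> by (intro F_strict) auto
    moreover have "F (s * c) \<le> F (t * c)" using \<open>s < t\<close> c_pos by (intro F_mono) simp
    ultimately show False using that by simp
  qed
  show "s = t" if "0 < s \<and> F (s * c) - 1 / 2 = 1 - F s" "0 < t \<and> F (t * c) - 1 / 2 = 1 - F t" for s t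
    using *[of s t] *[of t s] that by simp
qed

end

theorem theorem7:
  fixes \<alpha> :: ereal
    and P :: "(real ^ 'n) measure"
    and k :: 'n
    and F :: "real \<Rightarrow> real"
    and c :: real
  assumes "1 < CARD('n)"
    and "0 < \<alpha>"
    and "prob_space P"
    and "sets P = sets borel"
    and "alpha_symmetric \<alpha> P"
    and "measure P {0} = 0"
    and "F = cdf (distr P borel (\<lambda>x. x $ k))"
    and "c = real CARD('n) powr (1 / 2 - real_of_ereal (1 / \<alpha>))"
  shows "(\<exists>!\<sigma>. 0 < \<sigma> \<and> F (\<sigma> * c) - 1 / 2 = 1 - F \<sigma>) \<and>
    (\<forall>\<sigma>. 0 < \<sigma> \<and> F (\<sigma> * c) - 1 / 2 = 1 - F \<sigma> \<longrightarrow>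
      (\<forall>S. is_arg_max (scatter_depth P) pos_def S \<longleftrightarrow> S = \<sigma>\<^sup>2 *\<^sub>R mat 1) \<and>
      scatter_depth P (\<sigma>\<^sup>2 *\<^sub>R mat 1) = (SUP S\<in>{S. pos_def S}. scatter_depth P S) \<and>
      (\<alpha> \<le> 2 \<longrightarrow>
        scatter_depth P (\<sigma>\<^sup>2 *\<^sub>R mat 1) = 2 * F (\<sigma> * c) - 1 \<and>
        scatter_depth P (\<sigma>\<^sup>2 *\<^sub>R mat 1) = 2 - 2 * F \<sigma>) \<and>
      (2 < \<alpha> \<longrightarrow>
        scatter_depth P (\<sigma>\<^sup>2 *\<^sub>R mat 1) = 2 * F \<sigma> - 1 \<and>
        scatter_depth P (\<sigma>\<^sup>2 *\<^sub>R mat 1) = 2 - 2 * F (\<sigma> * c)))"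
proof -
  interpret law: alpha_symmetric_law P \<alpha> k c
    using assms by (simp add: alpha_symmetric_law_def alpha_symmetric_law_axioms_def norm_ratio_def)
  have F: "law.F = F"
    using assms by (simp add: law.F_def)
  have SUP: "scatter_depth P (\<sigma>\<^sup>2 *\<^sub>R mat 1) = (SUP S\<in>{S. pos_def S}. scatter_depth P S)"
    if "is_arg_max (scatter_depth P) pos_def (\<sigma>\<^sup>2 *\<^sub>R mat 1)" for \<sigma>
    using that by (intro cSup_eq_maximum[symmetric]) (auto simp: is_arg_max_linorder)
  show ?thesis
  proof (intro conjI allI impI; (elim conjE)?)
    show "\<exists>!\<sigma>. 0 < \<sigma> \<and> F (\<sigma> * c) - 1 / 2 = 1 - F \<sigma>"
      using law.ex1_scale unfolding F .
  next
    fix \<sigma> assume \<sigma>: "0 < \<sigma>" and eq: "F (\<sigma> * c) - 1 / 2 = 1 - F \<sigma>"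
    note max = law.scatter_depth_maximum[unfolded F, OF \<sigma> eq]
    show "is_arg_max (scatter_depth P) pos_def S \<longleftrightarrow> S = \<sigma>\<^sup>2 *\<^sub>R mat 1" for S
      by (rule max(1))
    show "scatter_depth P (\<sigma>\<^sup>2 *\<^sub>R mat 1) = (SUP S\<in>{S. pos_def S}. scatter_depth P S)"
      by (rule SUP) (simp only: max(1))
    have "2 * F (\<sigma> * c) - 1 = 2 - 2 * F \<sigma>" using eq by simp
    then show "scatter_depth P (\<sigma>\<^sup>2 *\<^sub>R mat 1) = 2 * F (\<sigma> * c) - 1"
        "scatter_depth P (\<sigma>\<^sup>2 *\<^sub>R mat 1) = 2 - 2 * F \<sigma>" if "\<alpha> \<le> 2"
      using that unfolding max(2) law.low_def by simp_all
    show "scatter_depth P (\<sigma>\<^sup>2 *\<^sub>R mat 1) = 2 * F \<sigma> - 1"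
        "scatter_depth P (\<sigma>\<^sup>2 *\<^sub>R mat 1) = 2 - 2 * F (\<sigma> * c)" if "2 < \<alpha>"
      using that eq unfolding max(2) law.low_def by (simp_all flip: not_less)
  qed
qed

end
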